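(* Let $\Omega\subset\mathbb{R}^2$ be a bounded two-phase body with real scalar conductivities $\sigma^{(1)},\sigma^{(2)}$, where $\sigma^{(2)}\ne0$, with (known) nonzero volume fractions $f_1,f_2$ and thresholds $c^{(1)},c^{(2)}>0$. Let $(\mathbf{E}_m,\mathbf{J}_m)$, $m=1,2$, be the fields of two solutions of the conductivity equations in $\Omega$ (for two boundary conditions), and let $x^{(\alpha)},y^{(\alpha)},z^{(\alpha)},D^{(\alpha)}_{mn},\tau^{(\alpha)}$ and the reduced feasible and compatible regions be as defined in the context. If the material has not broken down for either boundary condition, then: (a) the reduced feasible region is nonempty and intersects the compatible region; (b) $x^{(2)}=(\langle\mathbf{E}_1\cdot\mathbf{J}_1\rangle-\sigma^{(1)}x^{(1)})/\sigma^{(2)}$, $y^{(2)}=(\langle\mathbf{E}_1\cdot\mathbf{J}_2\rangle-\sigma^{(1)}y^{(1)})/\sigma^{(2)}$, $z^{(2)}=(\langle\mathbf{E}_2\cdot\mathbf{J}_2\rangle-\sigma^{(1)}z^{(1)})/\sigma^{(2)}$; (c) for $\alpha=1,2$: $x^{(\alpha)}-D_{11}^{(\alpha)}/f_\alpha\ge0$ and $z^{(\alpha)}-D_{22}^{(\alpha)}/f_\alpha\ge0$, and hence $(c^{(\alpha)})^2f_\alpha^2\ge D_{11}^{(\alpha)}$ and $(c^{(\alpha)})^2f_\alpha^2\ge D_{22}^{(\alpha)}$; (d) for $\alpha=1,2$: $$\left((c^{(\alpha)})^2f_\alpha-\frac{D_{11}^{(\alpha)}}{f_\alpha}\right)\left((c^{(\alpha)})^2f_\alpha-\frac{D_{22}^{(\alpha)}}{f_\alpha}\right)\ge\left(y^{(\alpha)}-\frac{D_{12}^{(\alpha)}}{f_\alpha}\right)^2+\tau^{(\alpha)},$$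 and hence $$\left((c^{(\alpha)})^2f_\alpha-\frac{D_{11}^{(\alpha)}}{f_\alpha}\right)\left((c^{(\alpha)})^2f_\alpha-\frac{D_{22}^{(\alpha)}}{f_\alpha}\right)\ge\tau^{(\alpha)}.$$
   Context: Phase $\alpha$ occupies $\Omega_\alpha\subset\Omega$ with characteristic function $\chi_\alpha$ ($\chi_1+\chi_2=1$ in $\Omega$ up to measure zero), and $f_\alpha=|\Omega_\alpha|/|\Omega|$. $\langle\cdot\rangle$ denotes the average over $\Omega$. The fields are real, square integrable, and satisfy (weakly) $\nabla\cdot\mathbf{J}_m=0$, $\mathbf{E}_m=-\nabla V_m$, $\mathbf{J}_m=\sigma\mathbf{E}_m$, with $\sigma=\sigma^{(1)}\chi_1+\sigma^{(2)}\chi_2$. Put $\mathbf{E}_m^{(\alpha)}=\chi_\alpha\mathbf{E}_m$. The material has not broken down for either boundary condition means $|\mathbf{E}^{(\alpha)}_m(\mathbf{x})|\le c^{(\alpha)}$ for (almost) all $\mathbf{x}\in\Omega$ and $m,\alpha\in\{1,2\}$. Define $A^{(\alpha)}_{mn}=\langle\mathbf{E}_m^{(\alpha)}\cdot\mathbf{E}_n^{(\alpha)}\rangle$, $D^{(\alpha)}_{mn}=\langle\mathbf{E}_m^{(\alpha)}\rangle\cdot\langle\mathbf{E}_n^{(\alpha)}\rangle$, $x^{(\alpha)}=A_{11}^{(\alpha)}$, $y^{(\alpha)}=A_{21}^{(\alpha)}$, $z^{(\alpha)}=A_{22}^{(\alpha)}$. With $\mathbf{R}_\perp=\begin{bmatrix}0&1\\-1&0\end{bmatrix}$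 and $B_{12}^{(\alpha)}=\langle\mathbf{E}_1^{(\alpha)}\cdot\mathbf{R}_\perp\mathbf{E}_2^{(\alpha)}\rangle$, define $$\tau^{(\alpha)}=\left[B_{12}^{(\alpha)}-\frac{1}{f_\alpha}\langle\mathbf{E}_1^{(\alpha)}\rangle\cdot\mathbf{R}_\perp\langle\mathbf{E}_2^{(\alpha)}\rangle\right]^2.$$ Regions in $\mathbb{R}^3$: for an arbitrary triple $(X_1,Y_1,Z_1)\in\mathbb{R}^3$ put $X_2=(\langle\mathbf{E}_1\cdot\mathbf{J}_1\rangle-\sigma^{(1)}X_1)/\sigma^{(2)}$, $Y_2=(\langle\mathbf{E}_1\cdot\mathbf{J}_2\rangle-\sigma^{(1)}Y_1)/\sigma^{(2)}$, $Z_2=(\langle\mathbf{E}_2\cdot\mathbf{J}_2\rangle-\sigma^{(1)}Z_1)/\sigma^{(2)}$. The compatible region is the set of triples $(X_1,Y_1,Z_1)$ with $X_\alpha,Y_\alpha,Z_\alpha\le(c^{(\alpha)})^2f_\alpha$ for $\alpha=1,2$. The reduced feasible region is the set of triples for which, for both $\alpha=1,2$, the matrix $$\mathbf{S}^{(\alpha)}=\begin{bmatrix}X_\alpha-D_{11}^{(\alpha)}/f_\alpha & Y_\alpha-D_{12}^{(\alpha)}/f_\alpha\\ Y_\alpha-D_{21}^{(\alpha)}/f_\alpha & Z_\alpha-D_{22}^{(\alpha)}/f_\alpha\end{bmatrix}$$ is positive semidefinite and $\det\mathbf{S}^{(\alpha)}\ge\tau^{(\alpha)}$. *)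

theory Defs
  imports "HOL-Analysis.Analysis"
begin

text \<open>The phase labels and the labels of the two boundary conditions both range over
  the two-element type \<open>2\<close>, whose elements are \<open>1\<close> and \<open>2\<close> (with \<open>2 = 0\<close>, so that
  \<open>i = 1 \<or> i = 2\<close> and \<open>1 \<noteq> 2\<close>).\<close>

definition grad :: "(real^'n \<Rightarrow> real) \<Rightarrow> real^'n \<Rightarrow> real^'n" where
  "grad f x = (\<chi> i. frechet_derivative f (at x) (axis i 1))"

primrec continuously_diff :: "nat \<Rightarrow> (real^'n \<Rightarrow> real) \<Rightarrow> bool" where
  "continuously_diff 0 f \<longleftrightarrow> continuous_on UNIV f"
| "continuously_diff (Suc k) f \<longleftrightarrow>
     (\<forall>x. f differentiable at x) \<and> (\<forall>i. continuously_diff k (\<lambda>x. grad f x $ i))"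

definition test_function :: "(real^'n) set \<Rightarrow> (real^'n \<Rightarrow> real) \<Rightarrow> bool" where
  "test_function \<Omega> \<phi> \<longleftrightarrow>
     (\<forall>k. continuously_diff k \<phi>) \<and>
     compact (closure {x. \<phi> x \<noteq> 0}) \<and> closure {x. \<phi> x \<noteq> 0} \<subseteq> \<Omega>"

definition locally_integrable :: "(real^'n) set \<Rightarrow> (real^'n \<Rightarrow> 'b::euclidean_space) \<Rightarrow> bool" where
  "locally_integrable \<Omega> g \<longleftrightarrow>
     g \<in> borel_measurable (lebesgue_on \<Omega>) \<and>
     (\<forall>K. compact K \<and> K \<subseteq> \<Omega> \<longrightarrow> integrable (lebesgue_on K) g)"

definition square_integrable :: "(real^'n) set \<Rightarrow> (real^'n \<Rightarrow> 'b::euclidean_space) \<Rightarrow> bool" where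
  "square_integrable \<Omega> g \<longleftrightarrow>
     g \<in> borel_measurable (lebesgue_on \<Omega>) \<and> integrable (lebesgue_on \<Omega>) (\<lambda>x. (norm (g x))\<^sup>2)"

definition has_weak_gradient ::
  "(real^'n) set \<Rightarrow> (real^'n \<Rightarrow> real) \<Rightarrow> (real^'n \<Rightarrow> real^'n) \<Rightarrow> bool" where
  "has_weak_gradient \<Omega> V G \<longleftrightarrow>
     locally_integrable \<Omega> V \<and> locally_integrable \<Omega> G \<and>
     (\<forall>\<phi>. test_function \<Omega> \<phi> \<longrightarrow>
        (\<integral>x. V x *\<^sub>R grad \<phi> x \<partial>lebesgue_on \<Omega>) = - (\<integral>x. \<phi> x *\<^sub>R G x \<partial>lebesgue_on \<Omega>))"

definition weakly_divergence_free :: "(real^'n) set \<Rightarrow> (real^'n \<Rightarrow> real^'n) \<Rightarrow> bool" where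
  "weakly_divergence_free \<Omega> J \<longleftrightarrow>
     locally_integrable \<Omega> J \<and>
     (\<forall>\<phi>. test_function \<Omega> \<phi> \<longrightarrow> (\<integral>x. J x \<bullet> grad \<phi> x \<partial>lebesgue_on \<Omega>) = 0)"

definition two_phase_body :: "(real^2) set \<Rightarrow> (2 \<Rightarrow> (real^2) set) \<Rightarrow> bool" where
  "two_phase_body \<Omega> P \<longleftrightarrow>
     open \<Omega> \<and> bounded \<Omega> \<and>
     (\<forall>\<alpha>. P \<alpha> \<subseteq> \<Omega> \<and> P \<alpha> \<in> sets lebesgue) \<and>
     (AE x in lebesgue_on \<Omega>. indicat_real (P 1) x + indicat_real (P 2) x = 1)"

definition vol_frac :: "(real^2) set \<Rightarrow> (2 \<Rightarrow> (real^2) set) \<Rightarrow> 2 \<Rightarrow> real" where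
  "vol_frac \<Omega> P \<alpha> = measure lebesgue (P \<alpha>) / measure lebesgue \<Omega>"

definition conductivity :: "(2 \<Rightarrow> (real^2) set) \<Rightarrow> (2 \<Rightarrow> real) \<Rightarrow> real^2 \<Rightarrow> real" where
  "conductivity P \<sigma> x = \<sigma> 1 * indicat_real (P 1) x + \<sigma> 2 * indicat_real (P 2) x"

definition conductivity_solution ::
  "(real^2) set \<Rightarrow> (real^2 \<Rightarrow> real) \<Rightarrow> (real^2 \<Rightarrow> real) \<Rightarrow>
   (real^2 \<Rightarrow> real^2) \<Rightarrow> (real^2 \<Rightarrow> real^2) \<Rightarrow> bool" where
  "conductivity_solution \<Omega> s V E J \<longleftrightarrow>
     square_integrable \<Omega> E \<and> square_integrable \<Omega> J \<and>
     has_weak_gradient \<Omega> V (\<lambda>x. - E x) \<and>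
     weakly_divergence_free \<Omega> J \<and>
     (AE x in lebesgue_on \<Omega>. J x = s x *\<^sub>R E x)"

definition avg :: "(real^2) set \<Rightarrow> (real^2 \<Rightarrow> 'b::euclidean_space) \<Rightarrow> 'b" where
  "avg \<Omega> g = (\<integral>x. g x \<partial>lebesgue_on \<Omega>) /\<^sub>R measure lebesgue \<Omega>"

definition phase_field ::
  "(2 \<Rightarrow> (real^2) set) \<Rightarrow> (2 \<Rightarrow> real^2 \<Rightarrow> real^2) \<Rightarrow> 2 \<Rightarrow> 2 \<Rightarrow> real^2 \<Rightarrow> real^2" where
  "phase_field P E \<alpha> m x = indicat_real (P \<alpha>) x *\<^sub>R E m x"

definition no_breakdown ::
  "(real^2) set \<Rightarrow> (2 \<Rightarrow> (real^2) set) \<Rightarrow> (2 \<Rightarrow> real) \<Rightarrow> (2 \<Rightarrow> real^2 \<Rightarrow> real^2) \<Rightarrow> bool" where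
  "no_breakdown \<Omega> P c E \<longleftrightarrow>
     (\<forall>\<alpha> m. AE x in lebesgue_on \<Omega>. norm (phase_field P E \<alpha> m x) \<le> c \<alpha>)"

definition R_perp :: "real^2^2" where
  "R_perp = vector [vector [0, 1], vector [-1, 0]]"

definition A_mat ::
  "(real^2) set \<Rightarrow> (2 \<Rightarrow> (real^2) set) \<Rightarrow> (2 \<Rightarrow> real^2 \<Rightarrow> real^2) \<Rightarrow> 2 \<Rightarrow> 2 \<Rightarrow> 2 \<Rightarrow> real" where
  "A_mat \<Omega> P E \<alpha> m n = avg \<Omega> (\<lambda>x. phase_field P E \<alpha> m x \<bullet> phase_field P E \<alpha> n x)"

definition D_mat ::
  "(real^2) set \<Rightarrow> (2 \<Rightarrow> (real^2) set) \<Rightarrow> (2 \<Rightarrow> real^2 \<Rightarrow> real^2) \<Rightarrow> 2 \<Rightarrow> 2 \<Rightarrow> 2 \<Rightarrow> real" where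
  "D_mat \<Omega> P E \<alpha> m n = avg \<Omega> (phase_field P E \<alpha> m) \<bullet> avg \<Omega> (phase_field P E \<alpha> n)"

definition B12 ::
  "(real^2) set \<Rightarrow> (2 \<Rightarrow> (real^2) set) \<Rightarrow> (2 \<Rightarrow> real^2 \<Rightarrow> real^2) \<Rightarrow> 2 \<Rightarrow> real" where
  "B12 \<Omega> P E \<alpha> = avg \<Omega> (\<lambda>x. phase_field P E \<alpha> 1 x \<bullet> (R_perp *v phase_field P E \<alpha> 2 x))"

definition tau ::
  "(real^2) set \<Rightarrow> (2 \<Rightarrow> (real^2) set) \<Rightarrow> (2 \<Rightarrow> real^2 \<Rightarrow> real^2) \<Rightarrow> 2 \<Rightarrow> real" where
  "tau \<Omega> P E \<alpha> =
     (B12 \<Omega> P E \<alpha> - 1 / vol_frac \<Omega> P \<alpha> *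
        (avg \<Omega> (phase_field P E \<alpha> 1) \<bullet> (R_perp *v avg \<Omega> (phase_field P E \<alpha> 2))))\<^sup>2"

definition power_avg ::
  "(real^2) set \<Rightarrow> (2 \<Rightarrow> real^2 \<Rightarrow> real^2) \<Rightarrow> (2 \<Rightarrow> real^2 \<Rightarrow> real^2) \<Rightarrow> 2 \<Rightarrow> 2 \<Rightarrow> real" where
  "power_avg \<Omega> E J m n = avg \<Omega> (\<lambda>x. E m x \<bullet> J n x)"

text \<open>From a first-phase value \<open>t\<close>, the value in phase \<open>\<alpha>\<close>: \<open>t\<close> itself for \<open>\<alpha> = 1\<close>, and the
  value determined by the measured average \<open>p\<close> for \<open>\<alpha> = 2\<close>.\<close>

definition phase_val :: "(2 \<Rightarrow> real) \<Rightarrow> real \<Rightarrow> real \<Rightarrow> 2 \<Rightarrow> real" where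
  "phase_val \<sigma> p t \<alpha> = (if \<alpha> = 1 then t else (p - \<sigma> 1 * t) / \<sigma> 2)"

definition psd :: "real^'n^'n \<Rightarrow> bool" where
  "psd S \<longleftrightarrow> transpose S = S \<and> (\<forall>v. 0 \<le> v \<bullet> (S *v v))"

definition S_mat :: "(2 \<Rightarrow> 2 \<Rightarrow> real) \<Rightarrow> real \<Rightarrow> real \<Rightarrow> real \<Rightarrow> real \<Rightarrow> real^2^2" where
  "S_mat D f X Y Z =
     vector [vector [X - D 1 1 / f, Y - D 1 2 / f],
             vector [Y - D 2 1 / f, Z - D 2 2 / f]]"

definition compatible_region ::
  "(real^2) set \<Rightarrow> (2 \<Rightarrow> (real^2) set) \<Rightarrow> (2 \<Rightarrow> real) \<Rightarrow> (2 \<Rightarrow> real) \<Rightarrow>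
   (2 \<Rightarrow> real^2 \<Rightarrow> real^2) \<Rightarrow> (2 \<Rightarrow> real^2 \<Rightarrow> real^2) \<Rightarrow> (real \<times> real \<times> real) set" where
  "compatible_region \<Omega> P \<sigma> c E J =
     {(X, Y, Z). \<forall>\<alpha>.
        phase_val \<sigma> (power_avg \<Omega> E J 1 1) X \<alpha> \<le> (c \<alpha>)\<^sup>2 * vol_frac \<Omega> P \<alpha> \<and>
        phase_val \<sigma> (power_avg \<Omega> E J 1 2) Y \<alpha> \<le> (c \<alpha>)\<^sup>2 * vol_frac \<Omega> P \<alpha> \<and>
        phase_val \<sigma> (power_avg \<Omega> E J 2 2) Z \<alpha> \<le> (c \<alpha>)\<^sup>2 * vol_frac \<Omega> P \<alpha>}"

definition reduced_feasible_region ::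
  "(real^2) set \<Rightarrow> (2 \<Rightarrow> (real^2) set) \<Rightarrow> (2 \<Rightarrow> real) \<Rightarrow>
   (2 \<Rightarrow> real^2 \<Rightarrow> real^2) \<Rightarrow> (2 \<Rightarrow> real^2 \<Rightarrow> real^2) \<Rightarrow> (real \<times> real \<times> real) set" where
  "reduced_feasible_region \<Omega> P \<sigma> E J =
     {(X, Y, Z). \<forall>\<alpha>.
        let S = S_mat (D_mat \<Omega> P E \<alpha>) (vol_frac \<Omega> P \<alpha>)
                  (phase_val \<sigma> (power_avg \<Omega> E J 1 1) X \<alpha>)
                  (phase_val \<sigma> (power_avg \<Omega> E J 1 2) Y \<alpha>)
                  (phase_val \<sigma> (power_avg \<Omega> E J 2 2) Z \<alpha>)
        in psd S \<and> det S \<ge> tau \<Omega> P E \<alpha>}"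

end

theory Submission
  imports Defs
begin

text \<open>On each phase subtract from the field its phase average, \<open>g\<^sub>m = \<chi>\<^sub>\<alpha> (E\<^sub>m - \<langle>E\<^sub>m\<^sup>\<alpha>\<rangle> / f\<^sub>\<alpha>)\<close>. Then the
  entries of the matrix \<open>S\<^sup>\<alpha>\<close> are \<open>\<langle>g\<^sub>m \<bullet> g\<^sub>n\<rangle>\<close>, and \<open>\<tau>\<^sup>\<alpha> = \<langle>g\<^sub>1 \<bullet> R g\<^sub>2\<rangle>\<^sup>2\<close> with \<open>R\<close> the rotation by a right
  angle. As \<open>g\<^sub>2\<close> and \<open>R g\<^sub>2\<close> are orthogonal and of the same norm, Bessel's inequality for \<open>g\<^sub>1\<close> with
  respect to these two gives
  \<open>\<langle>g\<^sub>1 \<bullet> g\<^sub>2\<rangle>\<^sup>2 + \<langle>g\<^sub>1 \<bullet> R g\<^sub>2\<rangle>\<^sup>2 \<le> \<langle>\<bar>g\<^sub>1\<bar>\<^sup>2\<rangle> \<langle>\<bar>g\<^sub>2\<bar>\<^sup>2\<rangle>\<close>, that is, \<open>det S\<^sup>\<alpha> \<ge> \<tau>\<^sup>\<alpha>\<close>. So the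
  true second moments of the fields lie in both regions.\<close>

section \<open>Quarter turn and Bessel's inequality\<close>

lemma R_perp_mult: "R_perp *v v = vector [v $ 2, - v $ 1]"
  by (simp add: R_perp_def vec_eq_iff forall_2 matrix_vector_mult_def sum_2)

lemma inner_R_perp_R_perp: "(R_perp *v v) \<bullet> (R_perp *v w) = v \<bullet> w"
  by (simp add: R_perp_mult inner_vec_def sum_2)

lemma norm_R_perp: "norm (R_perp *v v) = norm v"
  by (simp add: norm_eq_sqrt_inner inner_R_perp_R_perp)

text \<open>Setting \<open>r = c\<close> turns the quadratic into \<open>c * (a * c - b)\<close>,
  which settles \<open>c > 0\<close>. For \<open>c = 0\<close> this choice gives nothing; there
  \<open>r * (r * a - 2 * b)\<close> must stay nonnegative for small positive \<open>r\<close>,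
  which forces \<open>b = 0\<close>.\<close>

lemma quadratic_nonneg_imp_le:
  fixes a b c :: real
  assumes nonneg: "\<And>r. r\<^sup>2 * a - 2 * r * b + b * c \<ge> 0" and "b \<ge> 0" "c \<ge> 0"
  shows "b \<le> a * c"
proof (cases "c = 0")
  case True
  have "b = 0"
  proof (rule ccontr)
    assume "b \<noteq> 0"
    with \<open>b \<ge> 0\<close> have b: "b > 0" by simp
    \<comment> \<open>Small enough that \<open>r * \<bar>a\<bar> < b\<close>; the added 1 keeps the
      denominator positive when \<open>a = 0\<close>.\<close>
    define r where "r = b / (\<bar>a\<bar> + 1)"
    have r: "r > 0" using b by (simp add: r_def)
    have "r * a \<le> r * \<bar>a\<bar>"
      using r by (intro mult_left_mono) auto
    also have "\<dots> < b"
      using b by (simp add: r_def divide_simps)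
    finally have "r * (r * a - 2 * b) < 0"
      using r b by (intro mult_pos_neg) auto
    with nonneg[of r] True show False
      by (simp add: power2_eq_square algebra_simps)
  qed
  with True show ?thesis by simp
next
  case False
  with \<open>c \<ge> 0\<close> have "c > 0" by simp
  have "0 \<le> c * (a * c - b)"
    using nonneg[of c] by (simp add: power2_eq_square algebra_simps)
  with \<open>c > 0\<close> show ?thesis
    by (simp add: zero_le_mult_iff)
qed

lemma has_bochner_integral_nonneg:
  fixes g :: "'a \<Rightarrow> real"
  assumes "has_bochner_integral M g I" and "\<And>x. g x \<ge> 0"
  shows "I \<ge> 0"
  using assms by (auto simp: has_bochner_integral_iff)

text \<open>For \<open>Z > 0\<close> the projection of \<open>g\<close> onto the span of
  \<open>h\<close> and \<open>R_perp *v h\<close> has coefficients \<open>u / Z\<close> and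
  \<open>w / Z\<close>. Using
  \<open>r *\<^sub>R g - u *\<^sub>R h - w *\<^sub>R (R_perp *v h)\<close> with a free
  \<open>r\<close> in place of the residual avoids dividing by \<open>Z\<close>, which may vanish;
  \<open>r = Z\<close> gives back \<open>Z\<close> times the residual.\<close>

lemma Bessel_R_perp:
  fixes g h :: "'a \<Rightarrow> real^2"
  assumes gg: "has_bochner_integral M (\<lambda>x. g x \<bullet> g x) X"
    and hh: "has_bochner_integral M (\<lambda>x. h x \<bullet> h x) Z"
    and gh: "has_bochner_integral M (\<lambda>x. g x \<bullet> h x) u"
    and gRh: "has_bochner_integral M (\<lambda>x. g x \<bullet> (R_perp *v h x)) w"
  shows "u\<^sup>2 + w\<^sup>2 \<le> X * Z"
proof (rule quadratic_nonneg_imp_le)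
  show "Z \<ge> 0"
    using hh by (rule has_bochner_integral_nonneg) simp
next
  fix r :: real
  have "has_bochner_integral M
      (\<lambda>x. r\<^sup>2 * (g x \<bullet> g x) - 2 * r * u * (g x \<bullet> h x) - 2 * r * w * (g x \<bullet> (R_perp *v h x))
         + (u\<^sup>2 + w\<^sup>2) * (h x \<bullet> h x))
      (r\<^sup>2 * X - 2 * r * u * u - 2 * r * w * w + (u\<^sup>2 + w\<^sup>2) * Z)"
    by (intro has_bochner_integral_add has_bochner_integral_diff
          has_bochner_integral_mult_right assms)
  \<comment> \<open>The mixed term in \<open>u * w\<close> vanishes pointwise because
    \<open>R_perp *v h x\<close> is orthogonal to \<open>h x\<close>, and equality of their norms
    merges the last two squares.\<close>
  moreover have "r\<^sup>2 * (g x \<bullet> g x) - 2 * r * u * (g x \<bullet> h x) - 2 * r * w * (g x \<bullet> (R_perp *v h x))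
      + (u\<^sup>2 + w\<^sup>2) * (h x \<bullet> h x) = (norm (r *\<^sub>R g x - u *\<^sub>R h x - w *\<^sub>R (R_perp *v h x)))\<^sup>2" for x
    by (simp add: power2_norm_eq_inner R_perp_mult inner_vec_def sum_2)
      (simp add: power2_eq_square algebra_simps)
  ultimately have "0 \<le> r\<^sup>2 * X - 2 * r * u * u - 2 * r * w * w + (u\<^sup>2 + w\<^sup>2) * Z"
    by (auto intro: has_bochner_integral_nonneg)
  then show "0 \<le> r\<^sup>2 * X - 2 * r * (u\<^sup>2 + w\<^sup>2) + (u\<^sup>2 + w\<^sup>2) * Z"
    by (simp add: power2_eq_square algebra_simps)
qed simp

text \<open>The covariance identity on \<open>S\<close>: each mixed term contributes minus the
  product of the integrals over \<open>measure M S\<close>, and the constant term restores it once.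
  The indicator equations say that \<open>F\<close> and \<open>G\<close> vanish off
  \<open>S\<close>, so integrals over the whole space are integrals over \<open>S\<close>. Two
  separate functions are allowed so that one of them can be a rotated field.\<close>

lemma has_bochner_integral_fluctuation:
  fixes F G :: "'a \<Rightarrow> 'b::euclidean_space"
  assumes S: "S \<in> sets M" "emeasure M S < \<infinity>" "measure M S \<noteq> 0"
    and F: "integrable M F" "\<And>x. indicat_real S x *\<^sub>R F x = F x"
    and G: "integrable M G" "\<And>x. indicat_real S x *\<^sub>R G x = G x"
    and FG: "integrable M (\<lambda>x. F x \<bullet> G x)"
  shows "has_bochner_integral M
    (\<lambda>x. (F x - indicat_real S x *\<^sub>R (integral\<^sup>L M F /\<^sub>R measure M S)) \<bullet>
         (G x - indicat_real S x *\<^sub>R (integral\<^sup>L M G /\<^sub>R measure M S)))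
    ((\<integral>x. F x \<bullet> G x \<partial>M) - (integral\<^sup>L M F \<bullet> integral\<^sup>L M G) / measure M S)"
proof -
  define a where "a = integral\<^sup>L M F /\<^sub>R measure M S"
  define b where "b = integral\<^sup>L M G /\<^sub>R measure M S"
  have "has_bochner_integral M
      (\<lambda>x. F x \<bullet> G x - F x \<bullet> b - a \<bullet> G x + indicat_real S x * (a \<bullet> b))
      ((\<integral>x. F x \<bullet> G x \<partial>M) - integral\<^sup>L M F \<bullet> b - a \<bullet> integral\<^sup>L M G + measure M S * (a \<bullet> b))"
    using assms
    by (intro has_bochner_integral_add has_bochner_integral_diff has_bochner_integral_mult_left
          has_bochner_integral_inner_left has_bochner_integral_inner_right
          has_bochner_integral_integrable has_bochner_integral_real_indicator) auto
  moreover have "F x \<bullet> G x - F x \<bullet> b - a \<bullet> G x + indicat_real S x * (a \<bullet> b)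
      = (F x - indicat_real S x *\<^sub>R a) \<bullet> (G x - indicat_real S x *\<^sub>R b)" for x
  proof (cases "x \<in> S")
    case False
    then have "F x = 0" "G x = 0"
      using F(2)[of x] G(2)[of x] by simp_all
    with False show ?thesis by simp
  qed (simp add: inner_diff_left inner_diff_right)
  moreover have "(\<integral>x. F x \<bullet> G x \<partial>M) - integral\<^sup>L M F \<bullet> b - a \<bullet> integral\<^sup>L M G + measure M S * (a \<bullet> b)
      = (\<integral>x. F x \<bullet> G x \<partial>M) - (integral\<^sup>L M F \<bullet> integral\<^sup>L M G) / measure M S"
    using S(3) by (simp add: a_def b_def divide_simps)
  ultimately show ?thesis
    by (simp only: a_def b_def)
qed

text \<open>Completing the square after multiplication by \<open>p = S $ 1 $ 1\<close> leaves the
  determinant as the coefficient of \<open>t\<^sup>2\<close>. If \<open>p = 0\<close>, then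
  \<open>q\<^sup>2 \<le> p * r\<close> kills the mixed term and the form is just
  \<open>r * t\<^sup>2\<close>.\<close>

lemma psd_2:
  fixes S :: "real^2^2"
  assumes sym: "S $ 2 $ 1 = S $ 1 $ 2"
    and nonneg: "S $ 1 $ 1 \<ge> 0" "S $ 2 $ 2 \<ge> 0" "det S \<ge> 0"
  shows "psd S"
  unfolding psd_def
proof (intro conjI allI)
  show "transpose S = S"
    using sym by (simp add: transpose_def vec_eq_iff forall_2)
  fix v :: "real^2"
  define p q r s t where "p = S $ 1 $ 1" and "q = S $ 1 $ 2" and "r = S $ 2 $ 2"
    and "s = v $ 1" and "t = v $ 2"
  have pr: "p \<ge> 0" "r \<ge> 0" "q\<^sup>2 \<le> p * r"
    using nonneg sym by (simp_all add: p_def q_def r_def det_2 power2_eq_square)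
  have "0 \<le> p * s\<^sup>2 + 2 * q * s * t + r * t\<^sup>2"
  proof (cases "p = 0")
    case True
    then have "q = 0" using pr by simp
    with True pr show ?thesis by simp
  next
    case False
    have "p * (p * s\<^sup>2 + 2 * q * s * t + r * t\<^sup>2) = (p * s + q * t)\<^sup>2 + (p * r - q\<^sup>2) * t\<^sup>2"
      by (simp add: power2_eq_square algebra_simps)
    also have "\<dots> \<ge> 0" using pr by simp
    finally show ?thesis using False pr by (simp add: zero_le_mult_iff)
  qed
  also have "\<dots> = v \<bullet> (S *v v)"
    using sym by (simp add: p_def q_def r_def s_def t_def inner_vec_def matrix_vector_mult_def sum_2
        power2_eq_square algebra_simps)
  finally show "0 \<le> v \<bullet> (S *v v)" .
qed

section \<open>Integrability and bounds for the phase fields\<close>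

locale unbroken_body =
  fixes \<Omega> :: "(real^2) set" and P :: "2 \<Rightarrow> (real^2) set"
    and \<sigma> c :: "2 \<Rightarrow> real"
    and V :: "2 \<Rightarrow> real^2 \<Rightarrow> real" and E J :: "2 \<Rightarrow> real^2 \<Rightarrow> real^2"
  assumes body: "two_phase_body \<Omega> P"
    and vol_frac_nz: "\<And>\<alpha>. vol_frac \<Omega> P \<alpha> \<noteq> 0"
    and sol: "\<And>m. conductivity_solution \<Omega> (conductivity P \<sigma>) (V m) (E m) (J m)"
    and nb: "no_breakdown \<Omega> P c E"
    and c_pos: "\<And>\<alpha>. c \<alpha> > 0"
begin

abbreviation "M \<equiv> lebesgue_on \<Omega>"
abbreviation "F \<equiv> phase_field P E"
abbreviation "f \<equiv> vol_frac \<Omega> P"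

lemma Omega_lmeasurable: "\<Omega> \<in> lmeasurable"
  using body by (auto simp: two_phase_body_def intro: lmeasurable_open)

sublocale finite_measure M
  using Omega_lmeasurable
  by (intro finite_measureI) (auto simp: emeasure_restrict_space fmeasurable_def)

lemma phase_sets: "P \<alpha> \<in> sets M"
  using body Omega_lmeasurable
  by (auto simp: two_phase_body_def sets_restrict_space_iff fmeasurable_def)

lemma measure_phase: "measure M (P \<alpha>) = measure lebesgue (P \<alpha>)"
  using body Omega_lmeasurable
  by (auto simp: two_phase_body_def fmeasurable_def intro!: measure_restrict_space)

text \<open>Division by zero yields 0, so a nonzero volume fraction forces both its numerator and
  its denominator to be nonzero.\<close>

lemma measure_Omega_pos: "measure lebesgue \<Omega> > 0"
  using vol_frac_nz[of 1] by (auto simp: vol_frac_def zero_less_measure_iff)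

lemma measure_phase_pos: "measure M (P \<alpha>) > 0"
  using vol_frac_nz[of \<alpha>] by (auto simp: vol_frac_def measure_phase zero_less_measure_iff)

lemma vol_frac_pos: "f \<alpha> > 0"
  using measure_Omega_pos measure_phase_pos[of \<alpha>] by (simp add: vol_frac_def measure_phase)

lemma field_measurable [measurable]: "E m \<in> borel_measurable M" "J m \<in> borel_measurable M"
  using sol[of m] by (auto simp: conductivity_solution_def square_integrable_def)

lemma phase_field_measurable [measurable]: "F \<alpha> m \<in> borel_measurable M"
  unfolding phase_field_def[abs_def] using phase_sets[of \<alpha>] by measurable

lemma phase_field_bound: "AE x in M. norm (F \<alpha> m x) \<le> c \<alpha>"
  using nb by (simp add: no_breakdown_def)

lemma phase_field_indicator: "indicat_real (P \<alpha>) x *\<^sub>R F \<alpha> m x = F \<alpha> m x"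
  by (simp add: phase_field_def indicator_def)

lemma phase_field_integrable: "integrable M (F \<alpha> m)"
  using phase_field_bound by (rule integrable_const_bound) simp

lemma phase_field_R_perp_integrable: "integrable M (\<lambda>x. R_perp *v F \<alpha> m x)"
  by (rule integrable_bounded_linear[OF matrix_vector_mul_bounded_linear phase_field_integrable])

lemma phase_field_R_perp_integral:
  "(\<integral>x. R_perp *v F \<alpha> m x \<partial>M) = R_perp *v (\<integral>x. F \<alpha> m x \<partial>M)"
  by (rule integral_bounded_linear[OF matrix_vector_mul_bounded_linear phase_field_integrable])

text \<open>The indicator is kept on the right so that integration gives the area of the phase,
  hence the factor \<open>f \<alpha>\<close> in \<open>A_mat_le\<close>, and not the area of the
  whole body.\<close>

lemma phase_field_inner_le:
  "AE x in M. \<bar>F \<alpha> m x \<bullet> F \<alpha> n x\<bar> \<le> (c \<alpha>)\<^sup>2 * indicat_real (P \<alpha>) x"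
  using phase_field_bound[of \<alpha> m] phase_field_bound[of \<alpha> n]
proof eventually_elim
  case (elim x)
  show ?case
  proof (cases "x \<in> P \<alpha>")
    case True
    have "\<bar>F \<alpha> m x \<bullet> F \<alpha> n x\<bar> \<le> norm (F \<alpha> m x) * norm (F \<alpha> n x)"
      by (rule Cauchy_Schwarz_ineq2)
    also have "\<dots> \<le> c \<alpha> * c \<alpha>"
      using elim c_pos[of \<alpha>] by (intro mult_mono) auto
    finally show ?thesis using True by (simp add: power2_eq_square)
  qed (simp add: phase_field_def)
qed

lemma phase_field_inner_integrable: "integrable M (\<lambda>x. F \<alpha> m x \<bullet> F \<alpha> n x)"
proof (rule integrable_const_bound)
  show "AE x in M. norm (F \<alpha> m x \<bullet> F \<alpha> n x) \<le> (c \<alpha>)\<^sup>2"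
    using phase_field_inner_le[of \<alpha> m n]
    by eventually_elim (rule order_trans, auto simp: indicator_def)
qed simp

lemma phase_field_inner_R_perp_integrable:
  "integrable M (\<lambda>x. F \<alpha> m x \<bullet> (R_perp *v F \<alpha> n x))"
proof (rule integrable_const_bound)
  show "AE x in M. norm (F \<alpha> m x \<bullet> (R_perp *v F \<alpha> n x)) \<le> c \<alpha> * c \<alpha>"
    using phase_field_bound[of \<alpha> m] phase_field_bound[of \<alpha> n]
  proof eventually_elim
    case (elim x)
    have "\<bar>F \<alpha> m x \<bullet> (R_perp *v F \<alpha> n x)\<bar> \<le> norm (F \<alpha> m x) * norm (R_perp *v F \<alpha> n x)"
      by (rule Cauchy_Schwarz_ineq2)
    also have "\<dots> \<le> c \<alpha> * c \<alpha>"
      using elim c_pos[of \<alpha>] by (intro mult_mono) (auto simp: norm_R_perp)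
    finally show ?case by simp
  qed
  show "(\<lambda>x. F \<alpha> m x \<bullet> (R_perp *v F \<alpha> n x)) \<in> borel_measurable M"
    using borel_measurable_integrable[OF phase_field_R_perp_integrable[of \<alpha> n]] by measurable
qed

lemma A_mat_le: "A_mat \<Omega> P E \<alpha> m n \<le> (c \<alpha>)\<^sup>2 * f \<alpha>"
proof -
  have "(\<integral>x. F \<alpha> m x \<bullet> F \<alpha> n x \<partial>M) \<le> (\<integral>x. (c \<alpha>)\<^sup>2 * indicat_real (P \<alpha>) x \<partial>M)"
  proof (rule integral_mono_AE)
    show "integrable M (\<lambda>x. (c \<alpha>)\<^sup>2 * indicat_real (P \<alpha>) x)"
      using phase_sets by (simp add: less_top[symmetric])
    show "AE x in M. F \<alpha> m x \<bullet> F \<alpha> n x \<le> (c \<alpha>)\<^sup>2 * indicat_real (P \<alpha>) x"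
      using phase_field_inner_le[of \<alpha> m n] by eventually_elim simp
  qed (rule phase_field_inner_integrable)
  also have "\<dots> = (c \<alpha>)\<^sup>2 * measure lebesgue (P \<alpha>)"
    using sets.sets_into_space[OF phase_sets[of \<alpha>]] by (simp add: measure_phase Int_absorb2)
  finally show ?thesis
    using measure_Omega_pos by (simp add: A_mat_def avg_def vol_frac_def divide_simps)
qed

lemma A_mat_commute: "A_mat \<Omega> P E \<alpha> m n = A_mat \<Omega> P E \<alpha> n m"
  by (simp add: A_mat_def inner_commute)

lemma D_mat_commute: "D_mat \<Omega> P E \<alpha> m n = D_mat \<Omega> P E \<alpha> n m"
  by (simp add: D_mat_def inner_commute)

section \<open>Second moments of the fluctuations\<close>

definition fluct :: "2 \<Rightarrow> 2 \<Rightarrow> real^2 \<Rightarrow> real^2" where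
  "fluct \<alpha> m x = F \<alpha> m x - indicat_real (P \<alpha>) x *\<^sub>R ((\<integral>x. F \<alpha> m x \<partial>M) /\<^sub>R measure M (P \<alpha>))"

text \<open>Integrals over \<Omega> are averages times its area, and the phase has
  \<open>f \<alpha>\<close> times that area. Hence the product of the two integrals over the area of
  the phase is \<open>D_mat \<Omega> P E \<alpha> m n / f \<alpha>\<close> times the area of
  \<Omega>.\<close>

lemma fluct_inner:
  "has_bochner_integral M (\<lambda>x. fluct \<alpha> m x \<bullet> fluct \<alpha> n x)
     (measure lebesgue \<Omega> * (A_mat \<Omega> P E \<alpha> m n - D_mat \<Omega> P E \<alpha> m n / f \<alpha>))"
proof -
  have "has_bochner_integral M (\<lambda>x. fluct \<alpha> m x \<bullet> fluct \<alpha> n x)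
     ((\<integral>x. F \<alpha> m x \<bullet> F \<alpha> n x \<partial>M)
        - ((\<integral>x. F \<alpha> m x \<partial>M) \<bullet> (\<integral>x. F \<alpha> n x \<partial>M)) / measure M (P \<alpha>))"
    unfolding fluct_def
    by (rule has_bochner_integral_fluctuation)
      (use measure_phase_pos[of \<alpha>] in \<open>auto simp: phase_sets phase_field_integrable
         phase_field_indicator phase_field_inner_integrable less_top[symmetric]\<close>)
  moreover have "(\<integral>x. F \<alpha> m x \<bullet> F \<alpha> n x \<partial>M)
        - ((\<integral>x. F \<alpha> m x \<partial>M) \<bullet> (\<integral>x. F \<alpha> n x \<partial>M)) / measure M (P \<alpha>)
      = measure lebesgue \<Omega> * (A_mat \<Omega> P E \<alpha> m n - D_mat \<Omega> P E \<alpha> m n / f \<alpha>)"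
    using measure_Omega_pos measure_phase_pos[of \<alpha>]
    by (simp add: A_mat_def D_mat_def avg_def vol_frac_def measure_phase field_simps)
  ultimately show ?thesis by simp
qed

text \<open>By linearity the rotation passes through the integral and the subtraction, so
  \<open>R_perp *v fluct \<alpha> 2 x\<close> is the fluctuation of the rotated field and the
  covariance identity applies. The factor after the area of \<Omega> is the number whose square is
  \<open>tau\<close>.\<close>

lemma fluct_inner_R_perp:
  "has_bochner_integral M (\<lambda>x. fluct \<alpha> 1 x \<bullet> (R_perp *v fluct \<alpha> 2 x))
     (measure lebesgue \<Omega> * (B12 \<Omega> P E \<alpha>
        - 1 / f \<alpha> * (avg \<Omega> (F \<alpha> 1) \<bullet> (R_perp *v avg \<Omega> (F \<alpha> 2)))))"
proof -
  have "has_bochner_integral M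
     (\<lambda>x. (F \<alpha> 1 x - indicat_real (P \<alpha>) x *\<^sub>R ((\<integral>x. F \<alpha> 1 x \<partial>M) /\<^sub>R measure M (P \<alpha>))) \<bullet>
        (R_perp *v F \<alpha> 2 x
           - indicat_real (P \<alpha>) x *\<^sub>R ((\<integral>x. R_perp *v F \<alpha> 2 x \<partial>M) /\<^sub>R measure M (P \<alpha>))))
     ((\<integral>x. F \<alpha> 1 x \<bullet> (R_perp *v F \<alpha> 2 x) \<partial>M)
        - ((\<integral>x. F \<alpha> 1 x \<partial>M) \<bullet> (\<integral>x. R_perp *v F \<alpha> 2 x \<partial>M)) / measure M (P \<alpha>))"
    by (rule has_bochner_integral_fluctuation)
      (use measure_phase_pos[of \<alpha>] in \<open>auto simp: phase_sets phase_field_integrable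
         phase_field_indicator phase_field_R_perp_integrable phase_field_inner_R_perp_integrable
         less_top[symmetric] simp flip: matrix_vector_mult_scaleR\<close>)
  moreover have "(\<integral>x. F \<alpha> 1 x \<bullet> (R_perp *v F \<alpha> 2 x) \<partial>M)
        - ((\<integral>x. F \<alpha> 1 x \<partial>M) \<bullet> (\<integral>x. R_perp *v F \<alpha> 2 x \<partial>M)) / measure M (P \<alpha>)
      = measure lebesgue \<Omega> * (B12 \<Omega> P E \<alpha>
          - 1 / f \<alpha> * (avg \<Omega> (F \<alpha> 1) \<bullet> (R_perp *v avg \<Omega> (F \<alpha> 2))))"
    using measure_Omega_pos measure_phase_pos[of \<alpha>]
    by (simp add: phase_field_R_perp_integral B12_def avg_def vol_frac_def measure_phase
        matrix_vector_mult_scaleR field_simps)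
  ultimately show ?thesis
    by (simp add: fluct_def phase_field_R_perp_integral
        matrix_vector_mult_diff_distrib matrix_vector_mult_scaleR)
qed

lemma A_mat_diag_ge: "A_mat \<Omega> P E \<alpha> m m - D_mat \<Omega> P E \<alpha> m m / f \<alpha> \<ge> 0"
proof -
  have "measure lebesgue \<Omega> * (A_mat \<Omega> P E \<alpha> m m - D_mat \<Omega> P E \<alpha> m m / f \<alpha>) \<ge> 0"
    using fluct_inner by (rule has_bochner_integral_nonneg) simp
  with measure_Omega_pos show ?thesis
    by (simp add: zero_le_mult_iff)
qed

lemma tau_le:
  "(A_mat \<Omega> P E \<alpha> 1 2 - D_mat \<Omega> P E \<alpha> 1 2 / f \<alpha>)\<^sup>2 + tau \<Omega> P E \<alpha> \<le>
   (A_mat \<Omega> P E \<alpha> 1 1 - D_mat \<Omega> P E \<alpha> 1 1 / f \<alpha>) * (A_mat \<Omega> P E \<alpha> 2 2 - D_mat \<Omega> P E \<alpha> 2 2 / f \<alpha>)"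
  (is "?u\<^sup>2 + _ \<le> ?X * ?Z")
proof -
  define w where "w = B12 \<Omega> P E \<alpha> - 1 / f \<alpha> * (avg \<Omega> (F \<alpha> 1) \<bullet> (R_perp *v avg \<Omega> (F \<alpha> 2)))"
  define k where "k = measure lebesgue \<Omega>"
  \<comment> \<open>All four integrals carry the area \<open>k\<close>, and both sides are of degree
    two in it, so \<open>k\<^sup>2\<close> cancels.\<close>
  have "(k * ?u)\<^sup>2 + (k * w)\<^sup>2 \<le> (k * ?X) * (k * ?Z)"
    unfolding k_def w_def
    by (rule Bessel_R_perp[OF fluct_inner fluct_inner fluct_inner fluct_inner_R_perp])
  then have "k\<^sup>2 * (?u\<^sup>2 + w\<^sup>2) \<le> k\<^sup>2 * (?X * ?Z)"
    by (simp add: power2_eq_square algebra_simps)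
  then have "?u\<^sup>2 + w\<^sup>2 \<le> ?X * ?Z"
    using measure_Omega_pos by (simp add: k_def)
  then show ?thesis
    by (simp add: tau_def w_def)
qed

section \<open>Power averages and membership in the two regions\<close>

lemma power_avg_eq:
  "power_avg \<Omega> E J m n = \<sigma> 1 * A_mat \<Omega> P E 1 m n + \<sigma> 2 * A_mat \<Omega> P E 2 m n"
proof -
  have J: "AE x in M. J n x = conductivity P \<sigma> x *\<^sub>R E n x"
    using sol[of n] by (simp add: conductivity_solution_def)
  have P: "AE x in M. indicat_real (P 1) x + indicat_real (P 2) x = 1"
    using body by (simp add: two_phase_body_def)
  have "(\<integral>x. E m x \<bullet> J n x \<partial>M)
      = (\<integral>x. \<sigma> 1 * (F 1 m x \<bullet> F 1 n x) + \<sigma> 2 * (F 2 m x \<bullet> F 2 n x) \<partial>M)"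
  proof (rule integral_cong_AE)
    \<comment> \<open>Almost everywhere exactly one indicator is 1; there both sides reduce to the
      conductivity of that phase times \<open>E m x \<bullet> E n x\<close>.\<close>
    show "AE x in M. E m x \<bullet> J n x = \<sigma> 1 * (F 1 m x \<bullet> F 1 n x) + \<sigma> 2 * (F 2 m x \<bullet> F 2 n x)"
      using J P
      by eventually_elim (auto simp: conductivity_def phase_field_def indicator_def split: if_splits)
  qed measurable
  also have "\<dots> = \<sigma> 1 * (\<integral>x. F 1 m x \<bullet> F 1 n x \<partial>M) + \<sigma> 2 * (\<integral>x. F 2 m x \<bullet> F 2 n x \<partial>M)"
    by (simp add: phase_field_inner_integrable)
  finally show ?thesis
    by (simp add: power_avg_def A_mat_def avg_def algebra_simps)
qed

text \<open>Solving \<open>power_avg_eq\<close> for the second phase recovers its true moment, so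
  membership in either region becomes a statement about \<open>A_mat\<close> in each phase
  separately.\<close>

lemma phase_val_A_mat:
  assumes "\<sigma> 2 \<noteq> 0"
  shows "phase_val \<sigma> (power_avg \<Omega> E J m n) (A_mat \<Omega> P E 1 m n) \<alpha> = A_mat \<Omega> P E \<alpha> m n"
  using assms exhaust_2[of \<alpha>] by (auto simp: phase_val_def power_avg_eq)

lemma A_mat_in_compatible_region:
  assumes "\<sigma> 2 \<noteq> 0"
  shows "(A_mat \<Omega> P E 1 1 1, A_mat \<Omega> P E 1 1 2, A_mat \<Omega> P E 1 2 2)
    \<in> compatible_region \<Omega> P \<sigma> c E J"
  by (simp add: compatible_region_def phase_val_A_mat[OF assms] A_mat_le)

lemma A_mat_in_reduced_feasible_region:
  assumes "\<sigma> 2 \<noteq> 0"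
  shows "(A_mat \<Omega> P E 1 1 1, A_mat \<Omega> P E 1 1 2, A_mat \<Omega> P E 1 2 2)
    \<in> reduced_feasible_region \<Omega> P \<sigma> E J"
proof -
  have "psd S \<and> det S \<ge> tau \<Omega> P E \<alpha>"
    if S: "S = S_mat (D_mat \<Omega> P E \<alpha>) (f \<alpha>)
      (A_mat \<Omega> P E \<alpha> 1 1) (A_mat \<Omega> P E \<alpha> 1 2) (A_mat \<Omega> P E \<alpha> 2 2)" for S \<alpha>
  proof
    show det: "det S \<ge> tau \<Omega> P E \<alpha>"
      using tau_le[of \<alpha>] D_mat_commute[of \<alpha> 2 1]
      by (simp add: S S_mat_def det_2 power2_eq_square)
    \<comment> \<open>As \<open>tau\<close> is a square, the determinant bound also supplies the
      nonnegative determinant that \<open>psd_2\<close> asks for.\<close>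
    have "0 \<le> tau \<Omega> P E \<alpha>"
      by (simp add: tau_def)
    with det have "det S \<ge> 0" by linarith
    then show "psd S"
      using A_mat_diag_ge[of \<alpha>] D_mat_commute[of \<alpha> 2 1]
      by (intro psd_2) (simp_all add: S S_mat_def)
  qed
  then show ?thesis
    by (simp add: reduced_feasible_region_def phase_val_A_mat[OF assms] Let_def)
qed

end

section \<open>Consequences of the moment inequalities\<close>

theorem theorem3p2:
  fixes \<Omega> :: "(real^2) set" and P :: "2 \<Rightarrow> (real^2) set"
    and \<sigma> c f :: "2 \<Rightarrow> real"
    and V :: "2 \<Rightarrow> real^2 \<Rightarrow> real" and E J :: "2 \<Rightarrow> real^2 \<Rightarrow> real^2"
    and x y z \<tau> :: "2 \<Rightarrow> real" and D :: "2 \<Rightarrow> 2 \<Rightarrow> 2 \<Rightarrow> real"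
  assumes body: "two_phase_body \<Omega> P"
    and f: "f = vol_frac \<Omega> P" and f_nz: "\<And>\<alpha>. f \<alpha> \<noteq> 0"
    and \<sigma>_nz: "\<sigma> 2 \<noteq> 0"
    and c_pos: "\<And>\<alpha>. c \<alpha> > 0"
    and sol: "\<And>m. conductivity_solution \<Omega> (conductivity P \<sigma>) (V m) (E m) (J m)"
    and nb: "no_breakdown \<Omega> P c E"
    and x: "\<And>\<alpha>. x \<alpha> = A_mat \<Omega> P E \<alpha> 1 1"
    and y: "\<And>\<alpha>. y \<alpha> = A_mat \<Omega> P E \<alpha> 2 1"
    and z: "\<And>\<alpha>. z \<alpha> = A_mat \<Omega> P E \<alpha> 2 2"
    and D: "D = D_mat \<Omega> P E"
    and \<tau>: "\<tau> = tau \<Omega> P E"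
  shows
    "(reduced_feasible_region \<Omega> P \<sigma> E J \<noteq> {} \<and>
      reduced_feasible_region \<Omega> P \<sigma> E J \<inter> compatible_region \<Omega> P \<sigma> c E J \<noteq> {}) \<and>
     (x 2 = (power_avg \<Omega> E J 1 1 - \<sigma> 1 * x 1) / \<sigma> 2 \<and>
      y 2 = (power_avg \<Omega> E J 1 2 - \<sigma> 1 * y 1) / \<sigma> 2 \<and>
      z 2 = (power_avg \<Omega> E J 2 2 - \<sigma> 1 * z 1) / \<sigma> 2) \<and>
     (\<forall>\<alpha>. x \<alpha> - D \<alpha> 1 1 / f \<alpha> \<ge> 0 \<and> z \<alpha> - D \<alpha> 2 2 / f \<alpha> \<ge> 0 \<and>
          (c \<alpha>)\<^sup>2 * (f \<alpha>)\<^sup>2 \<ge> D \<alpha> 1 1 \<and> (c \<alpha>)\<^sup>2 * (f \<alpha>)\<^sup>2 \<ge> D \<alpha> 2 2) \<and>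
     (\<forall>\<alpha>. ((c \<alpha>)\<^sup>2 * f \<alpha> - D \<alpha> 1 1 / f \<alpha>) * ((c \<alpha>)\<^sup>2 * f \<alpha> - D \<alpha> 2 2 / f \<alpha>)
            \<ge> (y \<alpha> - D \<alpha> 1 2 / f \<alpha>)\<^sup>2 + \<tau> \<alpha> \<and>
          ((c \<alpha>)\<^sup>2 * f \<alpha> - D \<alpha> 1 1 / f \<alpha>) * ((c \<alpha>)\<^sup>2 * f \<alpha> - D \<alpha> 2 2 / f \<alpha>)
            \<ge> \<tau> \<alpha>)"
proof -
  interpret unbroken_body \<Omega> P \<sigma> c V E J
    using body f f_nz sol nb c_pos by unfold_locales auto
  have diag: "x \<alpha> - D \<alpha> 1 1 / f \<alpha> \<ge> 0" "z \<alpha> - D \<alpha> 2 2 / f \<alpha> \<ge> 0" for \<alpha>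
    using A_mat_diag_ge[of \<alpha>] by (simp_all add: x z D f)
  have le: "x \<alpha> \<le> (c \<alpha>)\<^sup>2 * f \<alpha>" "z \<alpha> \<le> (c \<alpha>)\<^sup>2 * f \<alpha>" for \<alpha>
    using A_mat_le[of \<alpha>] by (simp_all add: x z f)
  have "D \<alpha> 1 1 \<le> (c \<alpha>)\<^sup>2 * (f \<alpha>)\<^sup>2" "D \<alpha> 2 2 \<le> (c \<alpha>)\<^sup>2 * (f \<alpha>)\<^sup>2" for \<alpha>
  proof -
    have "f \<alpha> > 0" using vol_frac_pos by (simp add: f)
    moreover have "D \<alpha> 1 1 / f \<alpha> \<le> (c \<alpha>)\<^sup>2 * f \<alpha>" "D \<alpha> 2 2 / f \<alpha> \<le> (c \<alpha>)\<^sup>2 * f \<alpha>"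
      using diag[of \<alpha>] le[of \<alpha>] by linarith+
    ultimately show "D \<alpha> 1 1 \<le> (c \<alpha>)\<^sup>2 * (f \<alpha>)\<^sup>2" "D \<alpha> 2 2 \<le> (c \<alpha>)\<^sup>2 * (f \<alpha>)\<^sup>2"
      by (simp_all add: divide_le_eq power2_eq_square mult.assoc)
  qed
  moreover have det: "(y \<alpha> - D \<alpha> 1 2 / f \<alpha>)\<^sup>2 + \<tau> \<alpha>
      \<le> ((c \<alpha>)\<^sup>2 * f \<alpha> - D \<alpha> 1 1 / f \<alpha>) * ((c \<alpha>)\<^sup>2 * f \<alpha> - D \<alpha> 2 2 / f \<alpha>)" for \<alpha>
  proof -
    have "(y \<alpha> - D \<alpha> 1 2 / f \<alpha>)\<^sup>2 + \<tau> \<alpha> \<le> (x \<alpha> - D \<alpha> 1 1 / f \<alpha>) * (z \<alpha> - D \<alpha> 2 2 / f \<alpha>)"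
      using tau_le[of \<alpha>] by (simp add: x y z D f \<tau> A_mat_commute[of \<alpha> 2 1])
    \<comment> \<open>Each factor grows when \<open>x \<alpha>\<close> or \<open>z \<alpha>\<close>
      is replaced by its breakdown bound; \<open>diag\<close> gives the signs that make the product
      monotone.\<close>
    also have "\<dots> \<le> ((c \<alpha>)\<^sup>2 * f \<alpha> - D \<alpha> 1 1 / f \<alpha>) * ((c \<alpha>)\<^sup>2 * f \<alpha> - D \<alpha> 2 2 / f \<alpha>)"
      using diag[of \<alpha>] le[of \<alpha>] by (intro mult_mono) linarith+
    finally show ?thesis .
  qed
  moreover have "\<tau> \<alpha> \<le> ((c \<alpha>)\<^sup>2 * f \<alpha> - D \<alpha> 1 1 / f \<alpha>) * ((c \<alpha>)\<^sup>2 * f \<alpha> - D \<alpha> 2 2 / f \<alpha>)" for \<alpha>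
    using det[of \<alpha>] zero_le_power2[of "y \<alpha> - D \<alpha> 1 2 / f \<alpha>"] by linarith
  \<comment> \<open>\<open>y\<close> has the indices in the order 2, 1 and the power average in the
    order 1, 2; symmetry of \<open>A_mat\<close> reconciles them.\<close>
  moreover have "x 2 = (power_avg \<Omega> E J 1 1 - \<sigma> 1 * x 1) / \<sigma> 2"
      "y 2 = (power_avg \<Omega> E J 1 2 - \<sigma> 1 * y 1) / \<sigma> 2"
      "z 2 = (power_avg \<Omega> E J 2 2 - \<sigma> 1 * z 1) / \<sigma> 2"
    using \<sigma>_nz by (simp_all add: x y z power_avg_eq A_mat_commute[of _ 2 1])
  \<comment> \<open>The common point of the two regions is the triple of true second moments in
    phase 1.\<close>
  ultimately show ?thesis
    using diag A_mat_in_compatible_region[OF \<sigma>_nz] A_mat_in_reduced_feasible_region[OF \<sigma>_nz]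
    by blast
qed

end
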